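(* For each odd integer $p\ge3$, the Sierpiński carpet $S_p$ has Lipschitz dimension $1$. The Sierpiński gasket $G$ also has Lipschitz dimension $1$.
   Context: Sierpiński carpet $S_p$ ($p\ge3$ odd): divide the unit square in $\mathbb{R}^2$ into $p^2$ axis-parallel closed subsquares of side $1/p$ in the usual way and remove the (open) central one to get $S_p^1$; $S_p^n$ is obtained by performing the same procedure on each of the squares of side $p^{-(n-1)}$ remaining in $S_p^{n-1}$; $S_p=\bigcap_{n=1}^\infty S_p^n$. Sierpiński gasket $G$: start with a closed equilateral triangle in the plane, divide it into four congruent equilateral triangles, remove the (open) central one, and iterate this construction on the remaining three triangles of half the size; $G$ is the intersection of all generations. Both carry the Euclidean metric of $\mathbb{R}^2$. Lipschitz dimension: for $r>0$, an $r$-path in a metric space $X$ is a finite sequence $(x_1,\dots,x_k)$ in $X$ with $d(x_i,x_{i+1})\le r$ for $1\le i\le k-1$. Two points are in the same $r$-component of $X$ if some $r$-path in $X$ contains both. The $r$-components of a subset are those of the subset as a metric space. A map $f\colon X\to Y$ is Lipschitz light if there is $C>0$ such that $f$ is $C$-Lipschitz and, for every $r>0$ and every $W\subset Y$ with $\mathrm{diam}(W)\le r$, the $r$-components of $f^{-1}(W)$ have diameter at most $Cr$. The Lipschitz dimension $\dim_L(X)$ is the minimal integer $n\ge0$ such that there is a Lipschitz light map $X\to\mathbb{R}^n$ (with $\mathbb{R}^0$ a one-point space), or $\infty$ if there is none. *)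

theory Defs
  imports "HOL-Analysis.Analysis" "HOL-Library.Extended_Nat"
begin

text \<open>
  Euclidean space of a variable dimension \<open>n\<close>, including the one-point space for \<open>n = 0\<close>; the carrier is
  that of the library topology \<^const>\<open>Euclidean_space\<close>.
\<close>

definition Rn_metric :: "nat \<Rightarrow> (nat \<Rightarrow> real) metric" where
  "Rn_metric n = metric ({x. \<forall>i\<ge>n. x i = 0}, \<lambda>x y. L2_set (\<lambda>i. x i - y i) {..<n})"

lemma Metric_space_Rn:
  fixes n :: nat
  shows "Metric_space {x. \<forall>i\<ge>n. x i = 0} (\<lambda>x y. L2_set (\<lambda>i. x i - y i) {..<n} :: real)"
proof
  fix x y :: "nat \<Rightarrow> real"
  show "L2_set (\<lambda>i. x i - y i) {..<n} = L2_set (\<lambda>i. y i - x i) {..<n}"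
    by (simp add: L2_set_def power2_commute)
next
  fix x y :: "nat \<Rightarrow> real"
  assume "x \<in> {x. \<forall>i\<ge>n. x i = 0}" "y \<in> {x. \<forall>i\<ge>n. x i = 0}"
  then show "L2_set (\<lambda>i. x i - y i) {..<n} = 0 \<longleftrightarrow> x = y"
    by (auto simp: L2_set_eq_0_iff fun_eq_iff) (metis lessThan_iff not_le)
next
  fix x y z :: "nat \<Rightarrow> real"
  show "L2_set (\<lambda>i. x i - z i) {..<n} \<le>
      L2_set (\<lambda>i. x i - y i) {..<n} + L2_set (\<lambda>i. y i - z i) {..<n}"
    using L2_set_triangle_ineq[of "\<lambda>i. x i - y i" "\<lambda>i. y i - z i" "{..<n}"] by simp
qed simp

lemma mspace_Rn_metric [simp]: "mspace (Rn_metric n) = {x. \<forall>i\<ge>n. x i = 0}"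
  unfolding Rn_metric_def by (rule Metric_space.mspace_metric[OF Metric_space_Rn])

lemma mdist_Rn_metric [simp]: "mdist (Rn_metric n) x y = L2_set (\<lambda>i. x i - y i) {..<n}"
  unfolding Rn_metric_def by (simp add: Metric_space.mdist_metric[OF Metric_space_Rn])

definition ediam :: "'a metric \<Rightarrow> 'a set \<Rightarrow> ennreal" where
  "ediam M A = (SUP x\<in>A. SUP y\<in>A. ennreal (mdist M x y))"

definition r_path :: "'a metric \<Rightarrow> real \<Rightarrow> 'a list \<Rightarrow> bool" where
  "r_path M r xs \<longleftrightarrow> xs \<noteq> [] \<and> set xs \<subseteq> mspace M \<and>
     (\<forall>i. Suc i < length xs \<longrightarrow> mdist M (xs ! i) (xs ! Suc i) \<le> r)"

definition same_r_component :: "'a metric \<Rightarrow> real \<Rightarrow> ('a \<times> 'a) set" where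
  "same_r_component M r = {(x, y). \<exists>xs. r_path M r xs \<and> x \<in> set xs \<and> y \<in> set xs}"

definition r_components :: "'a metric \<Rightarrow> real \<Rightarrow> 'a set set" where
  "r_components M r = mspace M // same_r_component M r"

definition lipschitz_light :: "'a metric \<Rightarrow> 'b metric \<Rightarrow> ('a \<Rightarrow> 'b) \<Rightarrow> bool" where
  "lipschitz_light X Y f \<longleftrightarrow> f \<in> mspace X \<rightarrow> mspace Y \<and>
     (\<exists>C>0. (\<forall>x\<in>mspace X. \<forall>y\<in>mspace X. mdist Y (f x) (f y) \<le> C * mdist X x y) \<and>
       (\<forall>r>0. \<forall>W\<subseteq>mspace Y. ediam Y W \<le> ennreal r \<longrightarrow>
         (\<forall>K \<in> r_components (submetric X {x \<in> mspace X. f x \<in> W}) r. ediam X K \<le> ennreal (C * r))))"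

text \<open>The infimum of the empty set is \<open>\<infinity>\<close>.\<close>

definition lipschitz_dim :: "'a metric \<Rightarrow> enat" where
  "lipschitz_dim X = Inf {enat n | n. \<exists>f. lipschitz_light X (Rn_metric n) f}"

text \<open>
  \<open>carpet_corners p n\<close> is the set of lower left corners of the closed squares of side \<open>1 / p ^ n\<close> that
  remain at stage \<open>n\<close>. Position \<open>((p - 1) div 2, (p - 1) div 2)\<close> is the central one when \<open>p\<close> is odd.
  In \<^typ>\<open>real^2\<close>, the vector \<open>1\<close> has both coordinates \<open>1\<close>.
\<close>

primrec carpet_corners :: "nat \<Rightarrow> nat \<Rightarrow> (real^2) set" where
  "carpet_corners p 0 = {0}"
| "carpet_corners p (Suc n) =
     {a + (1 / real p ^ Suc n) *\<^sub>R vector [real i, real j] | a i j.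
        a \<in> carpet_corners p n \<and> i < p \<and> j < p \<and> (i, j) \<noteq> ((p - 1) div 2, (p - 1) div 2)}"

definition carpet_hole :: "nat \<Rightarrow> nat \<Rightarrow> real^2 \<Rightarrow> (real^2) set" where
  "carpet_hole p n a =
     (let s = 1 / real p ^ Suc n; m = a + (s * real ((p - 1) div 2)) *\<^sub>R 1 in box m (m + s *\<^sub>R 1))"

primrec carpet_stage :: "nat \<Rightarrow> nat \<Rightarrow> (real^2) set" where
  "carpet_stage p 0 = cbox 0 1"
| "carpet_stage p (Suc n) = carpet_stage p n - (\<Union>a\<in>carpet_corners p n. carpet_hole p n a)"

definition sierpinski_carpet :: "nat \<Rightarrow> (real^2) set" where
  "sierpinski_carpet p = (\<Inter>n\<in>{1..}. carpet_stage p n)"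

definition equilateral :: "real^2 \<Rightarrow> real^2 \<Rightarrow> real^2 \<Rightarrow> bool" where
  "equilateral a b c \<longleftrightarrow> a \<noteq> b \<and> dist a b = dist b c \<and> dist b c = dist c a"

text \<open>Triangles are represented by their triples of vertices.\<close>

primrec gasket_triangles ::
    "real^2 \<Rightarrow> real^2 \<Rightarrow> real^2 \<Rightarrow> nat \<Rightarrow> ((real^2) \<times> (real^2) \<times> (real^2)) set" where
  "gasket_triangles a b c 0 = {(a, b, c)}"
| "gasket_triangles a b c (Suc n) = (\<Union>(u, v, w)\<in>gasket_triangles a b c n.
     {(u, midpoint u v, midpoint u w),
      (midpoint u v, v, midpoint v w),
      (midpoint u w, midpoint v w, w)})"

primrec gasket_stage :: "real^2 \<Rightarrow> real^2 \<Rightarrow> real^2 \<Rightarrow> nat \<Rightarrow> (real^2) set" where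
  "gasket_stage a b c 0 = convex hull {a, b, c}"
| "gasket_stage a b c (Suc n) = gasket_stage a b c n -
     (\<Union>(u, v, w)\<in>gasket_triangles a b c n.
        interior (convex hull {midpoint u v, midpoint v w, midpoint u w}))"

definition sierpinski_gasket :: "real^2 \<Rightarrow> real^2 \<Rightarrow> real^2 \<Rightarrow> (real^2) set" where
  "sierpinski_gasket a b c = (\<Inter>n. gasket_stage a b c n)"

end

theory Submission
  imports Defs
begin

text \<open>
  The light map is linear. In suitable affine coordinates \<open>(x, y)\<close> both fractals are \<^emph>\<open>periodically
  punctured\<close>: there are an integer \<open>N \<ge> 2\<close>, a point \<open>(s, t)\<close> and \<open>\<delta> > 0\<close> such that, for every \<open>n\<close>, no
  point of the set has \<open>N\<^sup>n (x, y)\<close> within \<open>\<delta>\<close>, in both coordinates, of the lattice \<open>(s, t) + \<int>\<^sup>2\<close>.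
  For the carpet \<open>N = p\<close> and the lattice points are the centres of the grid squares of side \<open>p\<^sup>-\<^sup>n\<close>
  (\<open>sierpinski_carpet_avoids\<close>); for the gasket \<open>N = 2\<close> and they are the barycentres of the grid
  triangles that have the orientation of the initial one (\<open>sierpinski_gasket_avoids\<close>). It does not matter whether the cell around a hole
  survives up to stage \<open>n\<close>: if it does, its centre is removed at the next stage, and if it does not, its
  interior is gone already. All that is needed is that each stage is covered by its closed cells.

  For a bounded periodically punctured set the map \<open>f = y - x / \<delta>\<close> is Lipschitz light
  (\<open>lipschitz_light_of_lattice_holes\<close>). The lines \<open>f = c\<close> are so steep that while \<open>x\<close> crosses the
  middle half of a column of holes, of width \<open>\<delta>\<close> in units of \<open>N\<^sup>-\<^sup>n\<close>, \<open>y\<close> runs through a full period.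
  Hence every such line comes deep inside a hole of size about \<open>N\<^sup>-\<^sup>n\<close> whenever \<open>x\<close> advances by
  \<open>2 N\<^sup>-\<^sup>n\<close>. An \<open>r\<close>-path on which \<open>f\<close> varies by at most \<open>r\<close> stays within a multiple of \<open>r\<close> of such a
  line and has steps at most \<open>r\<close>, so it cannot jump over a hole that is much larger than \<open>r\<close>. The
  diameter of the path is therefore at most a multiple of \<open>r\<close>.

  The dimension is not \<open>0\<close>, as both sets contain a segment: a segment is a single \<open>r\<close>-component for
  every \<open>r > 0\<close>, and a constant map does not separate it (\<open>not_lipschitz_light_Rn_0\<close>).
\<close>

section \<open>Light maps to the line\<close>

text \<open>
  An \<open>r\<close>-path is not connected, so the intermediate value theorem holds for it only up to the
  variation of the function along one step.
\<close>

lemma list_discrete_ivt: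
  fixes g :: "'a \<Rightarrow> real"
  assumes step: "\<And>k. Suc k < length xs \<Longrightarrow> \<bar>g (xs ! k) - g (xs ! Suc k)\<bar> \<le> h"
    and ij: "i < length xs" "j < length xs" "g (xs ! i) \<le> v" "v \<le> g (xs ! j)"
    and "0 \<le> h"
    and obtained: "\<And>k. k < length xs \<Longrightarrow> \<bar>g (xs ! k) - v\<bar> \<le> h \<Longrightarrow> thesis"
  shows thesis
proof (rule ccontr)
  assume "\<not> thesis"
  then have far: "h < \<bar>g (xs ! k) - v\<bar>" if "k < length xs" for k
    using obtained[OF that] by argo
  have side: "g (xs ! k) < v \<longleftrightarrow> g (xs ! 0) < v" if "k < length xs" for k
    using that
  proof (induction k)
    case (Suc k)
    then show ?case
      using far[of k] far[of "Suc k"] step[of k] \<open>0 \<le> h\<close> by force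
  qed simp
  show False
    using side[OF ij(1)] side[OF ij(2)] far[OF ij(1)] far[OF ij(2)] ij(3,4) \<open>0 \<le> h\<close> by linarith
qed

lemma mdist_le_ediam:
  assumes "ediam M A \<le> ennreal r" "0 \<le> r" "x \<in> A" "y \<in> A"
  shows "mdist M x y \<le> r"
proof -
  have "ennreal (mdist M x y) \<le> ediam M A"
    unfolding ediam_def using assms(3,4) by (intro SUP_upper2[OF assms(3)] SUP_upper)
  then show ?thesis
    using assms(1,2) by (metis ennreal_le_iff order_trans)
qed

text \<open>
  Reduces lightness to a diameter bound along single paths. Both points of a path lie in the same
  component; two points of a component are joined through its representative, whence the factor 2.
\<close>

lemma lipschitz_light_realI:
  fixes X :: "'a::metric_space set" and f :: "'a \<Rightarrow> real"
  assumes "0 \<le> L" "0 \<le> C"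
    and lip: "\<And>z w. z \<in> X \<Longrightarrow> w \<in> X \<Longrightarrow> \<bar>f z - f w\<bar> \<le> L * dist z w"
    and path: "\<And>r zs i j. 0 < r \<Longrightarrow> set zs \<subseteq> X \<Longrightarrow>
        (\<And>k. Suc k < length zs \<Longrightarrow> dist (zs ! k) (zs ! Suc k) \<le> r) \<Longrightarrow>
        (\<And>z w. z \<in> set zs \<Longrightarrow> w \<in> set zs \<Longrightarrow> \<bar>f z - f w\<bar> \<le> r) \<Longrightarrow>
        i < length zs \<Longrightarrow> j < length zs \<Longrightarrow> dist (zs ! i) (zs ! j) \<le> C * r"
  shows "lipschitz_light (submetric euclidean_metric X) (Rn_metric 1) (\<lambda>z i. if i = 0 then f z else 0)"
    (is "lipschitz_light ?X _ ?f")
proof -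
  have norm1: "mdist (Rn_metric 1) (?f z) (?f w) = \<bar>f z - f w\<bar>" for z w
    by (simp add: L2_set_def lessThan_Suc)
  define D where "D = L + 2 * C + 1"
  have "0 < D" "L \<le> D" "2 * C \<le> D"
    using assms(1,2) by (auto simp: D_def)
  have lipD: "mdist (Rn_metric 1) (?f z) (?f w) \<le> D * mdist ?X z w" if "z \<in> X" "w \<in> X" for z w
    using lip[OF that] mult_right_mono[OF \<open>L \<le> D\<close>, of "dist z w"] unfolding norm1 by simp
  have light: "ediam ?X K \<le> ennreal (D * r)"
    if r: "0 < r" and W: "ediam (Rn_metric 1) W \<le> ennreal r"
      and K: "K \<in> r_components (submetric ?X {x \<in> mspace ?X. ?f x \<in> W}) r" for r W K
  proof -
    let ?Y = "submetric ?X {x \<in> mspace ?X. ?f x \<in> W}"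
    obtain z where K': "K = same_r_component ?Y r `` {z}"
      using K by (auto simp: r_components_def quotient_def)
    have near: "dist z w \<le> C * r" if w: "w \<in> K" for w
    proof -
      obtain zs where zs: "r_path ?Y r zs" "z \<in> set zs" "w \<in> set zs"
        using w unfolding K' same_r_component_def by blast
      obtain i j where ij: "i < length zs" "j < length zs" "zs ! i = z" "zs ! j = w"
        using zs(2,3) by (auto simp: in_set_conv_nth)
      have inY: "set zs \<subseteq> X" "\<And>v. v \<in> set zs \<Longrightarrow> ?f v \<in> W"
        using zs(1) by (auto simp: r_path_def)
      have "\<bar>f v - f v'\<bar> \<le> r" if "v \<in> set zs" "v' \<in> set zs" for v v'
        using mdist_le_ediam[OF W _ inY(2) inY(2), OF _ that] r unfolding norm1 by simp
      moreover have "dist (zs ! k) (zs ! Suc k) \<le> r" if "Suc k < length zs" for k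
        using zs(1) that by (auto simp: r_path_def)
      ultimately show ?thesis
        using path[OF r inY(1)] ij by blast
    qed
    have "mdist ?X v w \<le> D * r" if "v \<in> K" "w \<in> K" for v w
    proof -
      have "dist v w \<le> dist z v + dist z w"
        by (metis dist_commute dist_triangle)
      also have "\<dots> \<le> 2 * C * r"
        using near[OF that(1)] near[OF that(2)] by simp
      also have "\<dots> \<le> D * r"
        using \<open>2 * C \<le> D\<close> r by (intro mult_right_mono) auto
      finally show ?thesis by simp
    qed
    then show ?thesis
      unfolding ediam_def by (intro SUP_least ennreal_leI)
  qed
  show ?thesis
    unfolding lipschitz_light_def
  proof (intro conjI exI[of _ D])
    show "?f \<in> mspace ?X \<rightarrow> mspace (Rn_metric 1)" by auto
    show "\<forall>x\<in>mspace ?X. \<forall>y\<in>mspace ?X. mdist (Rn_metric 1) (?f x) (?f y) \<le> D * mdist ?X x y"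
      using lipD by auto
  qed (use \<open>0 < D\<close> light in blast)+
qed

section \<open>Periodically punctured sets\<close>

text \<open>
  The line \<open>y = c + x / \<delta>\<close>, scaled by \<open>m\<close>, meets the middle half of a hole, at height exactly \<open>t\<close>
  modulo 1, soon after any given abscissa \<open>a\<close>: over an interval on which \<open>m x\<close> grows by \<open>\<delta>\<close> the value
  \<open>m y\<close> grows by 1 and so meets \<open>t + \<int>\<close>.
\<close>

lemma lattice_hole_on_steep_line:
  fixes m :: real
  assumes "0 < m" "0 < \<delta>" "\<delta> \<le> 1"
  obtains x0 k l where "a \<le> x0" "x0 \<le> a + 2 / m" "\<bar>m * x0 - (s + of_int k)\<bar> \<le> \<delta> / 2"
    "m * (c + x0 / \<delta>) = t + of_int l"
proof -
  \<comment> \<open>\<open>b\<close> is the left end of the middle half of the first column of holes to the right of \<open>a\<close>, and \<open>e\<close> is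
    the part of a period that \<open>m y\<close> still has to rise from there.\<close>
  define k where "k = \<lceil>m * a - s + \<delta> / 2\<rceil>"
  define b where "b = (s + of_int k - \<delta> / 2) / m"
  define l where "l = \<lceil>m * (c + b / \<delta>) - t\<rceil>"
  define e where "e = t + of_int l - m * (c + b / \<delta>)"
  have mb: "m * b = s + of_int k - \<delta> / 2"
    using assms by (simp add: b_def)
  have k: "m * a \<le> m * b" "m * b + \<delta> \<le> m * a + 2"
    unfolding mb k_def using assms ceiling_correct[of "m * a - s + \<delta> / 2"] by linarith+
  have e: "0 \<le> e" "e \<le> 1"
    unfolding e_def l_def using ceiling_correct[of "m * (c + b / \<delta>) - t"] by linarith+
  have de: "0 \<le> \<delta> * e" "\<delta> * e \<le> \<delta>"
    using e assms by (auto intro: mult_left_le)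
  let ?x = "b + \<delta> * e / m"
  have mx: "m * ?x = m * b + \<delta> * e"
    using assms by (simp add: field_simps)
  show thesis
  proof (rule that[of ?x k l])
    have "m * (a + 2 / m) = m * a + 2"
      using assms by (simp add: field_simps)
    then have "m * a \<le> m * ?x" "m * ?x \<le> m * (a + 2 / m)"
      unfolding mx using k de by linarith+
    then show "a \<le> ?x" "?x \<le> a + 2 / m"
      using \<open>0 < m\<close> by (meson mult_le_cancel_left_pos)+
    show "\<bar>m * ?x - (s + of_int k)\<bar> \<le> \<delta> / 2"
      unfolding mx mb using de by linarith
    show "m * (c + ?x / \<delta>) = t + of_int l"
      using assms by (simp add: e_def field_simps)
  qed
qed

lemma exists_power_scale:
  fixes r :: real
  assumes "2 \<le> (N::nat)" "0 < r" "r < e"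
  obtains n where "real N ^ n * r < e" "e \<le> real N ^ Suc n * r"
proof -
  obtain n where n: "e / r < real N ^ n"
    using real_arch_pow[of "real N" "e / r"] assms by auto
  define P where "P n \<longleftrightarrow> e \<le> real N ^ n * r" for n
  have "P n"
    using n assms by (simp add: P_def field_simps)
  moreover have "\<not> P 0"
    using assms by (simp add: P_def)
  ultimately obtain m where "\<not> P m" "P (Suc m)"
    using ex_least_nat_less[of P n] by blast
  then show thesis
    using that[of m] by (simp add: P_def not_le)
qed

text \<open>
  The chart \<open>(x, y)\<close> is bi-Lipschitz, so linear coordinates in an oblique frame qualify. A path at scale
  \<open>r\<close> is compared with holes at the smallest scale \<open>N\<^sup>-\<^sup>n\<close> that is still large compared with \<open>r\<close>; in \<open>x\<close>
  the path cannot advance by \<open>2 N\<^sup>-\<^sup>n\<close>, because the line that it follows comes deep inside a hole within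
  that distance. For \<open>r\<close> so large
  that there is no such scale, boundedness of \<open>X\<close> gives the estimate.
\<close>

lemma lipschitz_light_of_lattice_holes:
  fixes X :: "'a::metric_space set" and x y :: "'a \<Rightarrow> real" and N :: nat
  assumes "2 \<le> N" "0 < \<delta>" "\<delta> \<le> 1" "bounded X" "0 \<le> M"
    and xlip: "\<And>z w. z \<in> X \<Longrightarrow> w \<in> X \<Longrightarrow> \<bar>x z - x w\<bar> \<le> M * dist z w"
    and ylip: "\<And>z w. z \<in> X \<Longrightarrow> w \<in> X \<Longrightarrow> \<bar>y z - y w\<bar> \<le> M * dist z w"
    and colip: "\<And>z w. z \<in> X \<Longrightarrow> w \<in> X \<Longrightarrow> dist z w \<le> M * (\<bar>x z - x w\<bar> + \<bar>y z - y w\<bar>)"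
    and hole: "\<And>n k l z. z \<in> X \<Longrightarrow> \<bar>real N ^ n * x z - (s + of_int k)\<bar> < \<delta> \<Longrightarrow>
        \<bar>real N ^ n * y z - (t + of_int l)\<bar> < \<delta> \<Longrightarrow> False"
  shows "lipschitz_light (submetric euclidean_metric X) (Rn_metric 1)
    (\<lambda>z i. if i = 0 then y z - x z / \<delta> else 0)"
proof -
  define f where "f z = y z - x z / \<delta>" for z
  \<comment> \<open>Where \<open>x\<close> is within \<open>M * r\<close> of \<open>x0\<close> and \<open>f\<close> is within \<open>r\<close> of \<open>c\<close>, the value \<open>y\<close> is within \<open>A * r\<close> of
    \<open>c + x0 / \<delta>\<close>, the height of the line \<open>f = c\<close> over \<open>x0\<close>.\<close>
  define A where "A = 1 + M / \<delta>"
  have "1 \<le> A" "M \<le> A"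
  proof -
    have "M * \<delta> \<le> M"
      using \<open>0 \<le> M\<close> \<open>\<delta> \<le> 1\<close> by (simp add: mult_left_le)
    then have "M \<le> M / \<delta>"
      using \<open>0 < \<delta>\<close> by (simp add: pos_le_divide_eq)
    then show "1 \<le> A" "M \<le> A"
      using \<open>0 \<le> M\<close> \<open>0 < \<delta>\<close> by (auto simp: A_def)
  qed
  obtain B where B: "\<And>z w. z \<in> X \<Longrightarrow> w \<in> X \<Longrightarrow> dist z w \<le> B" "0 \<le> B"
    using diameter_bounded_bound diameter_ge_0 \<open>bounded X\<close> by blast
  \<comment> \<open>\<open>E * r\<close> will bound the variation of \<open>x\<close>. The first summand of \<open>C\<close> is for large \<open>r\<close>, the second for
    the passage from \<open>x\<close> to the distance.\<close>
  define E where "E = 4 * N * A / \<delta>"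
  define C where "C = 2 * A * B / \<delta> + M * (E + 1 + E / \<delta>)"
  have "0 \<le> E" "0 \<le> C"
    using \<open>1 \<le> A\<close> \<open>0 < \<delta>\<close> \<open>0 \<le> M\<close> B(2) by (auto simp: E_def C_def)
  have flip: "\<bar>f z - f w\<bar> \<le> (M + M / \<delta>) * dist z w" if "z \<in> X" "w \<in> X" for z w
  proof -
    have "f z - f w = (y z - y w) - (x z - x w) / \<delta>"
      by (simp add: f_def diff_divide_distrib)
    then have "\<bar>f z - f w\<bar> \<le> \<bar>y z - y w\<bar> + \<bar>x z - x w\<bar> / \<delta>"
      using \<open>0 < \<delta>\<close> abs_triangle_ineq4[of "y z - y w" "(x z - x w) / \<delta>"] by simp
    also have "\<dots> \<le> M * dist z w + M * dist z w / \<delta>"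
      using xlip[OF that] ylip[OF that] \<open>0 < \<delta>\<close> by (intro add_mono divide_right_mono) auto
    finally show ?thesis
      by (simp add: algebra_simps)
  qed
  have path: "dist (zs ! i) (zs ! j) \<le> C * r"
    if r: "0 < r" and zs: "set zs \<subseteq> X"
      and step: "\<And>k. Suc k < length zs \<Longrightarrow> dist (zs ! k) (zs ! Suc k) \<le> r"
      and fr: "\<And>z w. z \<in> set zs \<Longrightarrow> w \<in> set zs \<Longrightarrow> \<bar>f z - f w\<bar> \<le> r"
      and ij: "i < length zs" "j < length zs" for r zs i j
  proof (cases "A * r < \<delta> / 2")
    case False
    have "dist (zs ! i) (zs ! j) \<le> B * 1"
      using B zs ij nth_mem by (metis mult.right_neutral subsetD)
    also have "\<dots> \<le> B * (2 * (A * r) / \<delta>)"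
      using False \<open>0 < \<delta>\<close> B(2) by (intro mult_left_mono) (auto simp: field_simps)
    also have "\<dots> = 2 * A * B / \<delta> * r"
      by simp
    also have "\<dots> \<le> C * r"
      using \<open>0 \<le> M\<close> \<open>0 \<le> E\<close> \<open>0 < \<delta>\<close> r unfolding C_def by (intro mult_right_mono) auto
    finally show ?thesis .
  next
    case True
    obtain n where n: "real N ^ n * (A * r) < \<delta> / 2" "\<delta> / 2 \<le> real N ^ Suc n * (A * r)"
      using exists_power_scale[OF \<open>2 \<le> N\<close> _ True] r \<open>1 \<le> A\<close> by auto
    define m where "m = real N ^ n"
    have "0 < m"
      using \<open>2 \<le> N\<close> by (simp add: m_def)
    have inX: "zs ! k \<in> X" if "k < length zs" for k
      using that zs nth_mem by blast
    have xstep: "\<bar>x (zs ! k) - x (zs ! Suc k)\<bar> \<le> M * r" if "Suc k < length zs" for k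
      using xlip[OF inX inX, of k "Suc k"] step[OF that] that \<open>0 \<le> M\<close>
      by (meson Suc_lessD mult_left_mono order_trans)
    have narrow: "x (zs ! j) - x (zs ! i) < 2 / m"
      if ij: "i < length zs" "j < length zs" for i j
    proof (rule ccontr)
      assume "\<not> ?thesis"
      then have long: "x (zs ! i) + 2 / m \<le> x (zs ! j)" by simp
      define c where "c = f (zs ! i)"
      obtain x0 k l where x0: "x (zs ! i) \<le> x0" "x0 \<le> x (zs ! i) + 2 / m"
        "\<bar>m * x0 - (s + of_int k)\<bar> \<le> \<delta> / 2" "m * (c + x0 / \<delta>) = t + of_int l"
        using lattice_hole_on_steep_line[OF \<open>0 < m\<close> \<open>0 < \<delta>\<close> \<open>\<delta> \<le> 1\<close>] by metis
      have "x0 \<le> x (zs ! j)"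
        using x0(2) long by simp
      \<comment> \<open>The path passes the abscissa \<open>x0\<close> at which its line is deep inside a hole.\<close>
      then obtain h where h: "h < length zs" "\<bar>x (zs ! h) - x0\<bar> \<le> M * r"
        using list_discrete_ivt[of zs x "M * r" i j x0] xstep ij x0(1) \<open>0 \<le> M\<close> r by auto
      define z where "z = zs ! h"
      have "\<bar>f z - c\<bar> \<le> r"
        using fr ij(1) h(1) by (simp add: c_def z_def)
      have "m * (M * r) \<le> m * (A * r)"
        using \<open>M \<le> A\<close> r \<open>0 < m\<close> by simp
      then have small: "m * (M * r) < \<delta> / 2" "m * (A * r) < \<delta> / 2"
        using n(1) by (auto simp: m_def)
      have "\<bar>m * x z - m * x0\<bar> = m * \<bar>x z - x0\<bar>"
        using \<open>0 < m\<close> by (simp add: abs_mult flip: right_diff_distrib)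
      also have "\<dots> \<le> m * (M * r)"
        using h(2) \<open>0 < m\<close> by (simp add: z_def)
      finally have X1: "\<bar>m * x z - (s + of_int k)\<bar> < \<delta>"
        using small(1) x0(3) by linarith
      have eq: "m * y z - (t + of_int l) = m * ((f z - c) + (x z - x0) / \<delta>)"
        unfolding x0(4)[symmetric] f_def by (simp add: algebra_simps diff_divide_distrib)
      have "\<bar>(f z - c) + (x z - x0) / \<delta>\<bar> \<le> \<bar>f z - c\<bar> + \<bar>x z - x0\<bar> / \<delta>"
        using \<open>0 < \<delta>\<close> abs_triangle_ineq[of "f z - c" "(x z - x0) / \<delta>"] by simp
      also have "\<dots> \<le> r + M * r / \<delta>"
        using \<open>\<bar>f z - c\<bar> \<le> r\<close> h(2) \<open>0 < \<delta>\<close> by (intro add_mono divide_right_mono) (auto simp: z_def)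
      also have "\<dots> = A * r"
        by (simp add: A_def algebra_simps)
      finally have "m * \<bar>(f z - c) + (x z - x0) / \<delta>\<bar> \<le> m * (A * r)"
        using \<open>0 < m\<close> by simp
      then have "\<bar>m * y z - (t + of_int l)\<bar> < \<delta>"
        unfolding eq abs_mult using small(2) \<open>0 < m\<close> \<open>0 < \<delta>\<close> by linarith
      then show False
        using hole[OF inX[OF h(1)], of n k l] X1 by (simp add: m_def z_def)
    qed
    have "2 / m \<le> E * r"
      using n(2) \<open>0 < m\<close> \<open>0 < \<delta>\<close> by (simp add: E_def m_def field_simps)
    then have dx: "\<bar>x (zs ! i) - x (zs ! j)\<bar> \<le> E * r"
      using narrow[OF ij] narrow[OF ij(2) ij(1)] by linarith
    have "y (zs ! i) - y (zs ! j) = (f (zs ! i) - f (zs ! j)) + (x (zs ! i) - x (zs ! j)) / \<delta>"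
      by (simp add: f_def diff_divide_distrib)
    then have "\<bar>y (zs ! i) - y (zs ! j)\<bar> \<le> \<bar>f (zs ! i) - f (zs ! j)\<bar> + \<bar>x (zs ! i) - x (zs ! j)\<bar> / \<delta>"
      using \<open>0 < \<delta>\<close> abs_triangle_ineq[of "f (zs ! i) - f (zs ! j)" "(x (zs ! i) - x (zs ! j)) / \<delta>"] by simp
    also have "\<dots> \<le> r + E * r / \<delta>"
      using fr ij dx \<open>0 < \<delta>\<close> by (intro add_mono divide_right_mono) auto
    finally have dy: "\<bar>y (zs ! i) - y (zs ! j)\<bar> \<le> r + E * r / \<delta>" .
    have "dist (zs ! i) (zs ! j) \<le> M * (E * r + (r + E * r / \<delta>))"
      using colip[OF inX[OF ij(1)] inX[OF ij(2)]] dx dy \<open>0 \<le> M\<close>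
      by (meson add_mono mult_left_mono order_trans)
    also have "\<dots> = M * (E + 1 + E / \<delta>) * r"
      by (simp add: algebra_simps)
    also have "\<dots> \<le> C * r"
      using r \<open>1 \<le> A\<close> B(2) \<open>0 < \<delta>\<close> by (simp add: C_def)
    finally show ?thesis .
  qed
  show ?thesis
    unfolding f_def[symmetric]
  proof (rule lipschitz_light_realI)
    show "0 \<le> M + M / \<delta>"
      using \<open>0 \<le> M\<close> \<open>0 < \<delta>\<close> by simp
  qed (fact \<open>0 \<le> C\<close> flip path)+
qed

section \<open>Positive dimension\<close>

text \<open>
  Equally spaced points form an \<open>r\<close>-path from \<open>a\<close> to \<open>b\<close> for every \<open>r > 0\<close>, inside the only fibre. A
  light map would then give \<open>dist a b \<le> C * r\<close> for all \<open>r\<close>; half of the critical \<open>r\<close> contradicts this.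
\<close>

lemma not_lipschitz_light_Rn_0:
  fixes X :: "'a::real_normed_vector set"
  assumes seg: "closed_segment a b \<subseteq> X" and "a \<noteq> b"
  shows "\<not> lipschitz_light (submetric euclidean_metric X) (Rn_metric 0) f"
proof
  let ?X = "submetric euclidean_metric X"
  assume "lipschitz_light ?X (Rn_metric 0) f"
  then obtain C where "0 < C" and fX: "f \<in> mspace ?X \<rightarrow> mspace (Rn_metric 0)"
    and C: "\<forall>r>0. \<forall>W\<subseteq>mspace (Rn_metric 0). ediam (Rn_metric 0) W \<le> ennreal r \<longrightarrow>
      (\<forall>K \<in> r_components (submetric ?X {x \<in> mspace ?X. f x \<in> W}) r. ediam ?X K \<le> ennreal (C * r))"
    unfolding lipschitz_light_def by (elim conjE exE) (rule that; assumption)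
  define W where "W = mspace (Rn_metric 0)"
  define r where "r = dist a b / (2 * C)"
  let ?Y = "submetric ?X {x \<in> mspace ?X. f x \<in> W}"
  have "0 < r"
    using \<open>0 < C\<close> \<open>a \<noteq> b\<close> by (simp add: r_def)
  obtain n where n: "dist a b / r < real n"
    using reals_Archimedean2 by blast
  moreover have "0 \<le> dist a b / r"
    using \<open>0 < r\<close> by simp
  ultimately have "0 < n"
    using of_nat_0_less_iff order_le_less_trans by blast
  define pt where "pt k = a + (real k / real n) *\<^sub>R (b - a)" for k
  have inY: "mspace ?Y = X"
    using fX by (auto simp: W_def)
  have pt: "pt k \<in> X" if "k \<le> n" for k
  proof -
    have "pt k = (1 - real k / real n) *\<^sub>R a + (real k / real n) *\<^sub>R b"
      by (simp add: pt_def algebra_simps)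
    then have "pt k \<in> closed_segment a b"
      using that \<open>0 < n\<close> unfolding in_segment by (intro exI[of _ "real k / real n"]) auto
    then show ?thesis
      using seg by blast
  qed
  have pts: "dist (pt k) (pt (Suc k)) \<le> r" for k
  proof -
    have "pt (Suc k) - pt k = (1 / real n) *\<^sub>R (b - a)"
      by (simp add: pt_def add_divide_distrib algebra_simps)
    then have "dist (pt (Suc k)) (pt k) = dist b a / real n"
      by (simp add: dist_norm)
    then have "dist (pt k) (pt (Suc k)) = dist a b / real n"
      by (simp only: dist_commute)
    then show ?thesis
      using less_imp_le[OF n] \<open>0 < n\<close> \<open>0 < r\<close> by (simp add: pos_divide_le_eq mult.commute)
  qed
  have "r_path ?Y r (map pt [0..<Suc n])"
    unfolding r_path_def inY using pt pts by (auto simp: less_Suc_eq_le nth_append)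
  moreover have "pt 0 = a" "pt n = b"
    using \<open>0 < n\<close> by (auto simp: pt_def)
  then have "a \<in> set (map pt [0..<Suc n])" "b \<in> set (map pt [0..<Suc n])"
    unfolding set_map set_upt by (metis atLeastLessThan_iff imageI le0 lessI zero_less_Suc)+
  ultimately have ab: "(a, a) \<in> same_r_component ?Y r" "(a, b) \<in> same_r_component ?Y r"
    unfolding same_r_component_def by blast+
  define K where "K = same_r_component ?Y r `` {a}"
  have "K \<in> r_components ?Y r"
    unfolding r_components_def K_def inY using seg by (intro quotientI) auto
  moreover have "ediam (Rn_metric 0) W \<le> ennreal r"
    unfolding ediam_def by (intro SUP_least) simp
  ultimately have "ediam ?X K \<le> ennreal (C * r)"
    using C \<open>0 < r\<close> unfolding W_def by blast
  then have "mdist ?X a b \<le> C * r"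
    by (rule mdist_le_ediam) (use ab \<open>0 < C\<close> \<open>0 < r\<close> in \<open>auto simp: K_def\<close>)
  then show False
    using \<open>0 < C\<close> \<open>a \<noteq> b\<close> by (simp add: r_def)
qed

lemma lipschitz_dim_eq_1I:
  fixes X :: "'a::real_normed_vector set"
  assumes "closed_segment a b \<subseteq> X" "a \<noteq> b"
    and "lipschitz_light (submetric euclidean_metric X) (Rn_metric 1) f"
  shows "lipschitz_dim (submetric euclidean_metric X) = 1"
proof -
  let ?S = "{enat n | n. \<exists>f. lipschitz_light (submetric euclidean_metric X) (Rn_metric n) f}"
  have "Inf ?S \<le> 1"
    using assms(3) by (intro Inf_lower) (auto simp: one_enat_def)
  moreover have "1 \<le> Inf ?S"
  proof (rule Inf_greatest)
    fix e assume "e \<in> ?S"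
    then obtain n f where "e = enat n" "lipschitz_light (submetric euclidean_metric X) (Rn_metric n) f"
      by blast
    moreover from this have "n \<noteq> 0"
      using not_lipschitz_light_Rn_0[OF assms(1,2)] by metis
    ultimately show "1 \<le> e"
      by (simp add: one_enat_def)
  qed
  ultimately show ?thesis
    unfolding lipschitz_dim_def by (rule antisym)
qed

section \<open>The carpet\<close>

lemma carpet_corners_lattice:
  assumes "a \<in> carpet_corners p n" "0 < p"
  shows "\<exists>k l :: nat. real p ^ n * a $ 1 = real k \<and> real p ^ n * a $ 2 = real l"
  using assms(1)
proof (induction n arbitrary: a)
  case (Suc n)
  then obtain a' i j where a: "a = a' + (1 / real p ^ Suc n) *\<^sub>R vector [real i, real j]"
    and "a' \<in> carpet_corners p n"
    by auto
  then obtain k l :: nat where kl: "real p ^ n * a' $ 1 = real k" "real p ^ n * a' $ 2 = real l"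
    using Suc.IH by blast
  have "real p ^ Suc n * a $ 1 = real p * (real p ^ n * a' $ 1) + real i"
    "real p ^ Suc n * a $ 2 = real p * (real p ^ n * a' $ 2) + real j"
    using \<open>0 < p\<close> by (simp_all add: a field_simps)
  then have "real p ^ Suc n * a $ 1 = real (p * k + i)" "real p ^ Suc n * a $ 2 = real (p * l + j)"
    unfolding kl by simp_all
  then show ?case by blast
qed auto

lemma mem_carpet_hole_iff:
  assumes "0 < p"
  shows "z \<in> carpet_hole p n a \<longleftrightarrow> (\<forall>i. real ((p - 1) div 2) < real p ^ Suc n * (z $ i - a $ i) \<and>
    real p ^ Suc n * (z $ i - a $ i) < real ((p - 1) div 2) + 1)"
proof -
  define P where "P = real p ^ Suc n"
  have "0 < P" using assms by (simp add: P_def)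
  show ?thesis
    unfolding carpet_hole_def Let_def P_def[symmetric] mem_box_cart using \<open>0 < P\<close>
    by (intro arg_cong[where f = All] ext) (auto simp: field_simps)
qed

text \<open>
  The step from one stage of the carpet to the next, in units of the smaller squares. The natural choice of digits fails only on the boundary of the central subsquare, and then a
  neighbour of it contains the point; the neighbours exist because \<open>1 \<le> m\<close> and \<open>m + 1 < p\<close>.
\<close>

lemma subsquare_off_centre:
  fixes x y :: real
  assumes "0 \<le> x" "x \<le> real p" "0 \<le> y" "y \<le> real p" "1 \<le> m" "m + 1 < p"
    and "\<not> (real m < x \<and> x < real m + 1 \<and> real m < y \<and> y < real m + 1)"
  obtains i j where "i < p" "j < p" "(i, j) \<noteq> (m, m)"
    "real i \<le> x" "x \<le> real i + 1" "real j \<le> y" "y \<le> real j + 1"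
proof -
  have digit: "\<exists>i<p. real i \<le> x \<and> x \<le> real i + 1" if "0 \<le> x" "x \<le> real p" for x
  proof (cases "x = real p")
    case True
    then show ?thesis
      using assms(6) by (intro exI[of _ "p - 1"]) auto
  next
    case False
    then show ?thesis
      using that by (intro exI[of _ "nat \<lfloor>x\<rfloor>"]) (auto, linarith+)
  qed
  obtain i j where ij: "i < p" "real i \<le> x" "x \<le> real i + 1" "j < p" "real j \<le> y" "y \<le> real j + 1"
    using digit[OF assms(1,2)] digit[OF assms(3,4)] by blast
  show thesis
  proof (cases "(i, j) = (m, m)")
    case True
    then have "i = m" "j = m" by auto
    then consider "x = real m" | "x = real m + 1" | "y = real m" | "y = real m + 1"
      using ij assms(7) by fastforce
    then show thesis
    proof cases
      case 1
      then show thesis using that[of "m - 1" j] ij \<open>i = m\<close> \<open>j = m\<close> assms(5,6) by auto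
    next
      case 2
      then show thesis using that[of "m + 1" j] ij \<open>i = m\<close> \<open>j = m\<close> assms(5,6) by auto
    next
      case 3
      then show thesis using that[of i "m - 1"] ij \<open>i = m\<close> \<open>j = m\<close> assms(5,6) by auto
    next
      case 4
      then show thesis using that[of i "m + 1"] ij \<open>i = m\<close> \<open>j = m\<close> assms(5,6) by auto
    qed
  qed (use that ij in blast)
qed

lemma carpet_stage_covered:
  assumes "odd p" "3 \<le> p" "z \<in> carpet_stage p n"
  shows "\<exists>a \<in> carpet_corners p n. \<forall>i. 0 \<le> real p ^ n * (z $ i - a $ i) \<and> real p ^ n * (z $ i - a $ i) \<le> 1"
  using assms(3)
proof (induction n)
  case 0
  then show ?case by (auto simp: mem_box_cart)
next
  case (Suc n)
  then obtain a where a: "a \<in> carpet_corners p n" "z \<notin> carpet_hole p n a"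
    and cell: "\<And>i. 0 \<le> real p ^ n * (z $ i - a $ i)" "\<And>i. real p ^ n * (z $ i - a $ i) \<le> 1"
    by fastforce
  define m where "m = (p - 1) div 2"
  have m: "1 \<le> m" "m + 1 < p"
    using assms(1,2) by (auto simp: m_def elim!: oddE)
  define P where "P = real p ^ Suc n"
  define w where "w i = P * (z $ i - a $ i)" for i
  have "0 < P" using assms(2) by (simp add: P_def)
  have w: "w i = real p * (real p ^ n * (z $ i - a $ i))" for i
    by (simp add: w_def P_def)
  have wb: "0 \<le> w i" "w i \<le> real p" for i
    unfolding w using cell[of i] by (auto intro: mult_left_le)
  have "\<not> (real m < w 1 \<and> w 1 < real m + 1 \<and> real m < w 2 \<and> w 2 < real m + 1)"
    using a(2) assms(2) by (auto simp: mem_carpet_hole_iff forall_2 w_def P_def m_def)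
  then obtain i j where ij: "i < p" "j < p" "(i, j) \<noteq> (m, m)"
    "real i \<le> w 1" "w 1 \<le> real i + 1" "real j \<le> w 2" "w 2 \<le> real j + 1"
    using subsquare_off_centre[OF wb wb m] by metis
  define a' where "a' = a + (1 / P) *\<^sub>R vector [real i, real j]"
  have "a' \<in> carpet_corners p (Suc n)"
    using a(1) ij(1-3) unfolding a'_def P_def m_def by auto
  moreover have "P * (z $ 1 - a' $ 1) = w 1 - real i" "P * (z $ 2 - a' $ 2) = w 2 - real j"
    using \<open>0 < P\<close> by (simp_all add: a'_def w_def field_simps)
  ultimately show ?case
    using ij(4-7) unfolding forall_2 P_def[symmetric] by (intro bexI[of _ a']) auto
qed

text \<open>
  The point is in the interior of a grid square of side \<open>p\<^sup>-\<^sup>n\<close>, so the square of stage \<open>n\<close> that covers it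
  can only be this one, and the centre of that square is removed at the next stage. With \<open>p = 2 m + 1\<close>,
  the hole of the unit square, from \<open>m / p\<close> to \<open>(m + 1) / p\<close>, is the set of points closer than
  \<open>1 / (2 p)\<close> to \<open>(1/2, 1/2)\<close> in both coordinates.
\<close>

lemma sierpinski_carpet_avoids:
  assumes "odd p" "3 \<le> p" "z \<in> sierpinski_carpet p"
    and x: "\<bar>real p ^ n * z $ 1 - (1/2 + of_int k)\<bar> < 1 / (2 * real p)"
    and y: "\<bar>real p ^ n * z $ 2 - (1/2 + of_int l)\<bar> < 1 / (2 * real p)"
  shows False
proof -
  have "z \<in> carpet_stage p (Suc n)"
    using assms(3) unfolding sierpinski_carpet_def by (rule INT_D) simp
  then have z: "z \<in> carpet_stage p n" "\<And>a. a \<in> carpet_corners p n \<Longrightarrow> z \<notin> carpet_hole p n a"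
    by auto
  then obtain a where a: "a \<in> carpet_corners p n" "z \<notin> carpet_hole p n a"
    and cell: "\<And>i. 0 \<le> real p ^ n * (z $ i - a $ i)" "\<And>i. real p ^ n * (z $ i - a $ i) \<le> 1"
    using carpet_stage_covered[OF assms(1,2) z(1)] by blast
  define m where "m = (p - 1) div 2"
  have "real p = 2 * real m + 1"
    using \<open>odd p\<close> by (auto simp: m_def elim!: oddE)
  have centre: "real m < real p ^ Suc n * (z $ i - a $ i) \<and> real p ^ Suc n * (z $ i - a $ i) < real m + 1"
    if "real p ^ n * a $ i = real k'" "\<bar>real p ^ n * z $ i - (1/2 + of_int k)\<bar> < 1 / (2 * real p)"
    for i k' and k :: int
  proof -
    define v where "v = real p ^ n * (z $ i - a $ i)"
    have v: "real p ^ n * z $ i = v + real k'"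
      using that(1) by (simp add: v_def right_diff_distrib)
    have "1 / (2 * real p) < 1 / 2"
      using assms(2) by (simp add: field_simps)
    \<comment> \<open>The covering square is the grid square with centre \<open>1/2 + k\<close>.\<close>
    then have "of_int (int k' - k) < (1::real)" "- 1 < (of_int (int k' - k) :: real)"
      using that(2) cell[of i] unfolding v v_def[symmetric] by auto
    then have "k = int k'" by linarith
    then have "\<bar>v - 1/2\<bar> < 1 / (2 * real p)"
      using that(2) unfolding v by simp
    then have "real p * \<bar>v - 1/2\<bar> < 1/2"
      using assms(2) by (simp add: field_simps)
    moreover have "\<bar>real p * v - real p / 2\<bar> = real p * \<bar>v - 1/2\<bar>"
      using abs_mult[of "real p" "v - 1/2"] by (simp add: right_diff_distrib)
    ultimately have "\<bar>real p * v - real p / 2\<bar> < 1/2"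
      by simp
    then have "real m < real p * v \<and> real p * v < real m + 1"
      using \<open>real p = 2 * real m + 1\<close> unfolding abs_less_iff by linarith
    moreover have "real p ^ Suc n * (z $ i - a $ i) = real p * v"
      by (simp add: v_def)
    ultimately show ?thesis by (simp only:)
  qed
  obtain k' l' :: nat where "real p ^ n * a $ 1 = real k'" "real p ^ n * a $ 2 = real l'"
    using carpet_corners_lattice[OF a(1)] assms(2) by auto
  then have "z \<in> carpet_hole p n a"
    using centre[OF _ x] centre[OF _ y] assms(2)
    by (auto simp: mem_carpet_hole_iff forall_2 m_def)
  then show False
    using a(2) by contradiction
qed

text \<open>
  A hole, being open, lies strictly above the bottom of its square, and all squares lie in the upper
  half plane.
\<close>

lemma bottom_edge_subset_carpet:
  assumes "0 < p"
  shows "closed_segment 0 (vector [1, 0]) \<subseteq> sierpinski_carpet p"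
proof
  fix z :: "real^2" assume "z \<in> closed_segment 0 (vector [1, 0])"
  then have z: "0 \<le> z $ 1" "z $ 1 \<le> 1" "z $ 2 = 0"
    by (auto simp: in_segment)
  have hole: "z \<notin> carpet_hole p n a" if "a \<in> carpet_corners p n" for n a
  proof
    assume "z \<in> carpet_hole p n a"
    then have "0 < real p ^ Suc n * (z $ 2 - a $ 2)"
      using assms by (auto simp: mem_carpet_hole_iff intro: le_less_trans[OF of_nat_0_le_iff])
    also have "\<dots> = - (real p * (real p ^ n * a $ 2))"
      by (simp add: z(3))
    also have "\<dots> \<le> 0"
      using carpet_corners_lattice[OF that assms] by auto
    finally show False by simp
  qed
  have "z \<in> carpet_stage p n" for n
    by (induction n) (use z hole in \<open>auto simp: mem_box_cart forall_2\<close>)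
  then show "z \<in> sierpinski_carpet p"
    by (simp add: sierpinski_carpet_def)
qed

lemma lipschitz_dim_sierpinski_carpet:
  assumes "odd p" "3 \<le> p"
  shows "lipschitz_dim (submetric euclidean_metric (sierpinski_carpet p)) = 1"
proof (rule lipschitz_dim_eq_1I)
  show "closed_segment 0 (vector [1, 0]) \<subseteq> sierpinski_carpet p"
    using assms by (intro bottom_edge_subset_carpet) simp
  show "(0 :: real^2) \<noteq> vector [1, 0]"
    by (simp add: vec_eq_iff forall_2)
  have "sierpinski_carpet p \<subseteq> carpet_stage p 1"
    unfolding sierpinski_carpet_def by (rule INT_lower) simp
  also have "\<dots> \<subseteq> cbox 0 1"
    by (simp only: One_nat_def carpet_stage.simps Diff_subset)
  finally have "bounded (sierpinski_carpet p)"
    using bounded_subset[OF bounded_cbox] by blast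
  then show "lipschitz_light (submetric euclidean_metric (sierpinski_carpet p)) (Rn_metric 1)
      (\<lambda>z i. if i = 0 then z $ 2 - z $ 1 / (1 / (2 * real p)) else 0)"
  proof (rule lipschitz_light_of_lattice_holes[where N = p and M = 1 and s = "1/2" and t = "1/2", rotated 3])
    fix z w :: "real^2"
    show "\<bar>z $ 1 - w $ 1\<bar> \<le> 1 * dist z w" "\<bar>z $ 2 - w $ 2\<bar> \<le> 1 * dist z w"
      using component_le_norm_cart[of "z - w"] by (simp_all add: dist_norm)
    show "dist z w \<le> 1 * (\<bar>z $ 1 - w $ 1\<bar> + \<bar>z $ 2 - w $ 2\<bar>)"
      using norm_le_l1_cart[of "z - w"] by (simp add: dist_norm sum_2)
  next
    fix n k l z
    assume "z \<in> sierpinski_carpet p" "\<bar>real p ^ n * z $ 1 - (1/2 + of_int k)\<bar> < 1 / (2 * real p)"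
      "\<bar>real p ^ n * z $ 2 - (1/2 + of_int l)\<bar> < 1 / (2 * real p)"
    then show False
      by (rule sierpinski_carpet_avoids[OF assms])
  qed (use assms in auto)
qed

section \<open>Affine coordinates adapted to a triangle\<close>

text \<open>
  The point with affine coordinates \<open>(x, y)\<close> in the frame in which the vertices \<open>a\<close>, \<open>b\<close>, \<open>c\<close> are
  \<open>(0, 0)\<close>, \<open>(1, 0)\<close>, \<open>(0, 1)\<close>. In this frame all gasket triangles have vertices with dyadic
  coordinates.
\<close>

definition oblique :: "'a::real_vector \<Rightarrow> 'a \<Rightarrow> 'a \<Rightarrow> real \<Rightarrow> real \<Rightarrow> 'a" where
  "oblique a b c x y = a + x *\<^sub>R (b - a) + y *\<^sub>R (c - a)"

lemma not_collinear_independent: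
  fixes a b c :: "'a::euclidean_space"
  assumes "\<not> collinear {a, b, c}" "x *\<^sub>R (b - a) + y *\<^sub>R (c - a) = 0"
  shows "x = 0 \<and> y = 0"
proof (rule ccontr)
  assume nz: "\<not> ?thesis"
  have nc: "\<not> collinear {0, b - a, c - a}"
    using assms(1) collinear_3[of b a c] by (simp add: insert_commute)
  show False
  proof (cases "y = 0")
    case True
    then have "b - a = 0"
      using nz assms(2) by auto
    then show False
      using nc by simp
  next
    case False
    have "y *\<^sub>R (c - a) = (- x) *\<^sub>R (b - a)"
      using assms(2) by (simp add: add_eq_0_iff)
    then have "(1 / y) *\<^sub>R y *\<^sub>R (c - a) = (1 / y) *\<^sub>R (- x) *\<^sub>R (b - a)"
      by simp
    then have "c - a = (- x / y) *\<^sub>R (b - a)"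
      using False by simp
    then show False
      using nc by (metis collinear_lemma)
  qed
qed

lemma oblique_eq_iff:
  fixes a b c :: "'a::euclidean_space"
  assumes "\<not> collinear {a, b, c}"
  shows "oblique a b c x y = oblique a b c x' y' \<longleftrightarrow> x = x' \<and> y = y'"
proof
  assume "oblique a b c x y = oblique a b c x' y'"
  then have "(x - x') *\<^sub>R (b - a) + (y - y') *\<^sub>R (c - a) = 0"
    by (simp add: oblique_def algebra_simps)
  then show "x = x' \<and> y = y'"
    using not_collinear_independent[OF assms] by force
qed simp

text \<open>
  The coordinates extend to Lipschitz functions of the whole space by means of a linear left inverse
  of the injective map \<open>(x, y) \<mapsto> x (b - a) + y (c - a)\<close>.
\<close>

lemma oblique_chart:
  fixes a b c :: "'a::euclidean_space"
  assumes "\<not> collinear {a, b, c}"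
  obtains x y M where "0 \<le> M" "\<And>s t. x (oblique a b c s t) = s" "\<And>s t. y (oblique a b c s t) = t"
    "\<And>z w. \<bar>x z - x w\<bar> \<le> M * dist z w" "\<And>z w. \<bar>y z - y w\<bar> \<le> M * dist z w"
    "\<And>s t s' t'. dist (oblique a b c s t) (oblique a b c s' t') \<le> M * (\<bar>s - s'\<bar> + \<bar>t - t'\<bar>)"
proof -
  define L where "L q = fst q *\<^sub>R (b - a) + snd q *\<^sub>R (c - a)" for q :: "real \<times> real"
  have "linear L"
    unfolding L_def by (intro linearI) (auto simp: algebra_simps)
  moreover have "inj L"
    using \<open>linear L\<close> not_collinear_independent[OF assms]
    by (auto simp: linear_injective_0 L_def prod_eq_iff)
  ultimately obtain g where g: "linear g" "\<And>q. g (L q) = q"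
    using linear_injective_left_inverse[of L] by (auto simp: fun_eq_iff)
  obtain B where B: "0 < B" "\<And>z. norm (g z) \<le> B * norm z"
    using linear_bounded_pos[OF g(1)] by blast
  define M where "M = B + norm (b - a) + norm (c - a)"
  define x where "x z = fst (g (z - a))" for z
  define y where "y z = snd (g (z - a))" for z
  have gdiff: "g (z - a) - g (w - a) = g (z - w)" for z w
    using linear_diff[OF g(1), of "z - a" "w - a"] by simp
  have gM: "norm (g (z - w)) \<le> M * dist z w" for z w
    using B(2)[of "z - w"] mult_right_mono[of B M "norm (z - w)"]
    by (simp add: M_def dist_norm)
  show thesis
  proof (rule that[of M x y])
    show "0 \<le> M" using B(1) by (simp add: M_def)
    show "x (oblique a b c s t) = s" "y (oblique a b c s t) = t" for s t
      using g(2)[of "(s, t)"] by (simp_all add: x_def y_def oblique_def L_def add.assoc)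
    show "\<bar>x z - x w\<bar> \<le> M * dist z w" for z w
      using norm_fst_le[of "fst (g (z - w))" "snd (g (z - w))"] gM[of z w]
      unfolding x_def fst_diff[symmetric] gdiff by simp
    show "\<bar>y z - y w\<bar> \<le> M * dist z w" for z w
      using norm_snd_le[of "snd (g (z - w))" "fst (g (z - w))"] gM[of z w]
      unfolding y_def snd_diff[symmetric] gdiff by simp
    show "dist (oblique a b c s t) (oblique a b c s' t') \<le> M * (\<bar>s - s'\<bar> + \<bar>t - t'\<bar>)" for s t s' t'
    proof -
      have "oblique a b c s t - oblique a b c s' t' = (s - s') *\<^sub>R (b - a) + (t - t') *\<^sub>R (c - a)"
        by (simp add: oblique_def algebra_simps)
      then have "dist (oblique a b c s t) (oblique a b c s' t')
          \<le> \<bar>s - s'\<bar> * norm (b - a) + \<bar>t - t'\<bar> * norm (c - a)"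
        by (metis dist_norm norm_triangle_ineq norm_scaleR)
      also have "\<dots> \<le> \<bar>s - s'\<bar> * M + \<bar>t - t'\<bar> * M"
        using B(1) by (intro add_mono mult_left_mono) (auto simp: M_def)
      finally show ?thesis
        by (simp add: algebra_simps)
    qed
  qed
qed

section \<open>The gasket\<close>

definition lattice_triangle :: "'a::real_vector \<Rightarrow> 'a \<Rightarrow> 'a \<Rightarrow> nat \<Rightarrow> nat \<Rightarrow> nat \<Rightarrow> 'a \<times> 'a \<times> 'a" where
  "lattice_triangle a b c n k l =
    (oblique a b c (real k / 2 ^ n) (real l / 2 ^ n),
     oblique a b c (real (k + 1) / 2 ^ n) (real l / 2 ^ n),
     oblique a b c (real k / 2 ^ n) (real (l + 1) / 2 ^ n))"

lemma midpoint_oblique: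
  "midpoint (oblique a b c x y) (oblique a b c x' y') = oblique a b c ((x + x') / 2) ((y + y') / 2)"
proof -
  have "oblique a b c x y + oblique a b c x' y' = 2 *\<^sub>R a + (x + x') *\<^sub>R (b - a) + (y + y') *\<^sub>R (c - a)"
    by (simp add: oblique_def algebra_simps scaleR_2)
  then show ?thesis
    by (simp add: midpoint_def oblique_def scaleR_right_distrib)
qed

text \<open>
  All three smaller triangles have the same orientation as the big one, so the triangles of every
  stage are translates of one triangle by lattice vectors.
\<close>

lemma lattice_triangle_subdivide:
  assumes "lattice_triangle a b c n k l = (p, q, r)"
  shows "(p, midpoint p q, midpoint p r) = lattice_triangle a b c (Suc n) (2 * k) (2 * l)"
    "(midpoint p q, q, midpoint q r) = lattice_triangle a b c (Suc n) (2 * k + 1) (2 * l)"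
    "(midpoint p r, midpoint q r, r) = lattice_triangle a b c (Suc n) (2 * k) (2 * l + 1)"
  using assms unfolding lattice_triangle_def
  by (auto simp: midpoint_oblique field_simps intro!: arg_cong2[where f = "oblique a b c"])

lemma gasket_triangles_lattice:
  assumes "t \<in> gasket_triangles a b c n"
  shows "\<exists>k l. t = lattice_triangle a b c n k l"
  using assms
proof (induction n arbitrary: t)
  case 0
  then show ?case
    by (intro exI[of _ 0]) (simp add: lattice_triangle_def oblique_def)
next
  case (Suc n)
  then obtain p q r where "(p, q, r) \<in> gasket_triangles a b c n"
    and t: "t \<in> {(p, midpoint p q, midpoint p r), (midpoint p q, q, midpoint q r),
      (midpoint p r, midpoint q r, r)}"
    by auto
  then obtain k l where "lattice_triangle a b c n k l = (p, q, r)"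
    using Suc.IH by metis
  from t lattice_triangle_subdivide[OF this] show ?case
    by (metis insertE singletonD)
qed

lemma gasket_triangles_subdivide:
  assumes "lattice_triangle a b c n k l \<in> gasket_triangles a b c n"
  shows "lattice_triangle a b c (Suc n) (2 * k) (2 * l) \<in> gasket_triangles a b c (Suc n)"
    "lattice_triangle a b c (Suc n) (2 * k + 1) (2 * l) \<in> gasket_triangles a b c (Suc n)"
    "lattice_triangle a b c (Suc n) (2 * k) (2 * l + 1) \<in> gasket_triangles a b c (Suc n)"
proof -
  obtain p q r where pqr: "lattice_triangle a b c n k l = (p, q, r)"
    by (cases "lattice_triangle a b c n k l") auto
  show "lattice_triangle a b c (Suc n) (2 * k) (2 * l) \<in> gasket_triangles a b c (Suc n)"
    "lattice_triangle a b c (Suc n) (2 * k + 1) (2 * l) \<in> gasket_triangles a b c (Suc n)"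
    "lattice_triangle a b c (Suc n) (2 * k) (2 * l + 1) \<in> gasket_triangles a b c (Suc n)"
    unfolding lattice_triangle_subdivide[OF pqr, symmetric] using assms pqr by force+
qed

definition medial_hole :: "'a::euclidean_space \<times> 'a \<times> 'a \<Rightarrow> 'a set" where
  "medial_hole = (\<lambda>(p, q, r). interior (convex hull {midpoint p q, midpoint q r, midpoint p r}))"

text \<open>
  With \<open>X\<close> and \<open>Y\<close> the coordinates relative to the cell, the barycentric coordinates with respect to the
  medial triangle, with vertices \<open>(1/2, 0)\<close>, \<open>(1/2, 1/2)\<close>, \<open>(0, 1/2)\<close>, are \<open>1 - 2 Y\<close>, \<open>2 X + 2 Y - 1\<close>
  and \<open>1 - 2 X\<close>; a point is interior when all of them are positive.
\<close>

lemma oblique_in_medial_hole_iff: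
  fixes a b c :: "real^2"
  assumes nc: "\<not> collinear {a, b, c}"
  shows "oblique a b c x y \<in> medial_hole (lattice_triangle a b c n k l) \<longleftrightarrow>
    2 ^ n * x - real k < 1/2 \<and> 2 ^ n * y - real l < 1/2 \<and>
    1/2 < (2 ^ n * x - real k) + (2 ^ n * y - real l)"
proof -
  let ?T = "oblique a b c"
  define h :: real where "h = 1 / 2 ^ n"
  define X where "X = 2 ^ n * x - real k"
  define Y where "Y = 2 ^ n * y - real l"
  have "0 < h" by (simp add: h_def)
  have xy: "x = h * (real k + X)" "y = h * (real l + Y)"
    by (simp_all add: h_def X_def Y_def)
  define p where "p = ?T (h * (real k + 1/2)) (h * real l)"
  define q where "q = ?T (h * (real k + 1/2)) (h * (real l + 1/2))"
  define r where "r = ?T (h * real k) (h * (real l + 1/2))"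
  have hole: "medial_hole (lattice_triangle a b c n k l) = interior (convex hull {p, q, r})"
    unfolding medial_hole_def lattice_triangle_def p_def q_def r_def
    by (simp add: midpoint_oblique h_def field_simps)
  have "\<not> collinear {p, q, r}"
  proof
    assume "collinear {p, q, r}"
    then have "collinear {0, p - q, r - q}"
      using collinear_3[of p q r] by simp
    moreover have "p - q = 0 *\<^sub>R (b - a) + (- h / 2) *\<^sub>R (c - a)" "r - q = (- h / 2) *\<^sub>R (b - a) + 0 *\<^sub>R (c - a)"
      by (simp_all add: p_def q_def r_def oblique_def algebra_simps add_divide_distrib)
    ultimately consider "0 *\<^sub>R (b - a) + (- h / 2) *\<^sub>R (c - a) = 0" | "(- h / 2) *\<^sub>R (b - a) + 0 *\<^sub>R (c - a) = 0"
      | e where "(- h / 2) *\<^sub>R (b - a) + 0 *\<^sub>R (c - a) = e *\<^sub>R (0 *\<^sub>R (b - a) + (- h / 2) *\<^sub>R (c - a))"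
      unfolding collinear_lemma by metis
    then show False
    proof cases
      case 3
      then have "(- h / 2) *\<^sub>R (b - a) + (e * h / 2) *\<^sub>R (c - a) = 0"
        by (simp add: algebra_simps)
      then show False
        using not_collinear_independent[OF nc] \<open>0 < h\<close> by fastforce
    qed (use not_collinear_independent[OF nc] \<open>0 < h\<close> in fastforce)+
  qed
  then have int: "interior (convex hull {p, q, r}) =
      {v. \<exists>\<alpha> \<beta> \<gamma>. 0 < \<alpha> \<and> 0 < \<beta> \<and> 0 < \<gamma> \<and> \<alpha> + \<beta> + \<gamma> = 1 \<and> \<alpha> *\<^sub>R p + \<beta> *\<^sub>R q + \<gamma> *\<^sub>R r = v}"
    by (intro interior_convex_hull_3_minimal) simp_all
  have comb: "\<alpha> *\<^sub>R p + \<beta> *\<^sub>R q + \<gamma> *\<^sub>R r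
      = ?T (h * (real k + (\<alpha> + \<beta>) / 2)) (h * (real l + (\<beta> + \<gamma>) / 2))"
    if "\<alpha> + \<beta> + \<gamma> = 1" for \<alpha> \<beta> \<gamma>
  proof -
    have aff: "\<alpha> *\<^sub>R ?T x1 y1 + \<beta> *\<^sub>R ?T x2 y2 + \<gamma> *\<^sub>R ?T x3 y3
        = ?T (\<alpha> * x1 + \<beta> * x2 + \<gamma> * x3) (\<alpha> * y1 + \<beta> * y2 + \<gamma> * y3)" for x1 x2 x3 y1 y2 y3
    proof -
      have "\<alpha> *\<^sub>R ?T x1 y1 + \<beta> *\<^sub>R ?T x2 y2 + \<gamma> *\<^sub>R ?T x3 y3 = (\<alpha> + \<beta> + \<gamma>) *\<^sub>R a
        + (\<alpha> * x1 + \<beta> * x2 + \<gamma> * x3) *\<^sub>R (b - a) + (\<alpha> * y1 + \<beta> * y2 + \<gamma> * y3) *\<^sub>R (c - a)"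
        by (simp add: oblique_def scaleR_left_distrib scaleR_right_distrib)
      then show ?thesis
        by (simp add: that oblique_def)
    qed
    have \<alpha>: "\<alpha> = 1 - \<beta> - \<gamma>" using that by simp
    show ?thesis
      unfolding p_def q_def r_def aff
      by (rule arg_cong2[where f = ?T]) (simp_all add: \<alpha> algebra_simps add_divide_distrib diff_divide_distrib)
  qed
  have "?T x y \<in> interior (convex hull {p, q, r}) \<longleftrightarrow>
      (\<exists>\<alpha> \<beta> \<gamma>. 0 < \<alpha> \<and> 0 < \<beta> \<and> 0 < \<gamma> \<and> \<alpha> + \<beta> + \<gamma> = 1 \<and> (\<alpha> + \<beta>) / 2 = X \<and> (\<beta> + \<gamma>) / 2 = Y)"
    unfolding int mem_Collect_eq using \<open>0 < h\<close>
    by (intro ex_cong1 conj_cong refl) (simp add: comb xy oblique_eq_iff[OF nc])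
  also have "\<dots> \<longleftrightarrow> X < 1/2 \<and> Y < 1/2 \<and> 1/2 < X + Y"
  proof
    assume "X < 1/2 \<and> Y < 1/2 \<and> 1/2 < X + Y"
    then have "0 < 1 - 2 * Y \<and> 0 < 2 * X + 2 * Y - 1 \<and> 0 < 1 - 2 * X \<and>
      (1 - 2 * Y) + (2 * X + 2 * Y - 1) + (1 - 2 * X) = 1 \<and>
      ((1 - 2 * Y) + (2 * X + 2 * Y - 1)) / 2 = X \<and> ((2 * X + 2 * Y - 1) + (1 - 2 * X)) / 2 = Y"
      by (auto simp: field_simps)
    then show "\<exists>\<alpha> \<beta> \<gamma>. 0 < \<alpha> \<and> 0 < \<beta> \<and> 0 < \<gamma> \<and> \<alpha> + \<beta> + \<gamma> = 1 \<and> (\<alpha> + \<beta>) / 2 = X \<and> (\<beta> + \<gamma>) / 2 = Y"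
      by blast
  qed auto
  finally show ?thesis
    unfolding hole X_def Y_def .
qed

text \<open>
  If a point of a cell is not in its open medial triangle, one of the three inequalities for the hole
  fails, and each of them bounds one of the three smaller triangles.
\<close>

lemma gasket_stage_covered:
  fixes a b c :: "real^2"
  assumes nc: "\<not> collinear {a, b, c}" and "z \<in> gasket_stage a b c n"
  shows "\<exists>k l x y. lattice_triangle a b c n k l \<in> gasket_triangles a b c n \<and> z = oblique a b c x y \<and>
    0 \<le> 2 ^ n * x - real k \<and> 0 \<le> 2 ^ n * y - real l \<and> (2 ^ n * x - real k) + (2 ^ n * y - real l) \<le> 1"
  using assms(2)
proof (induction n)
  case 0
  then obtain s x y where "0 \<le> s" "0 \<le> x" "0 \<le> y" "s + x + y = 1" and z: "z = s *\<^sub>R a + x *\<^sub>R b + y *\<^sub>R c"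
    by (auto simp: convex_hull_3)
  have s: "s = 1 - x - y"
    using \<open>s + x + y = 1\<close> by simp
  have "z = oblique a b c x y"
    unfolding z s by (simp add: oblique_def algebra_simps)
  moreover have "lattice_triangle a b c 0 0 0 \<in> gasket_triangles a b c 0"
    by (simp add: lattice_triangle_def oblique_def)
  ultimately show ?case
    using \<open>0 \<le> s\<close> \<open>0 \<le> x\<close> \<open>0 \<le> y\<close> \<open>s + x + y = 1\<close>
    by (intro exI[of _ 0] exI[of _ x] exI[of _ y]) auto
next
  case (Suc n)
  then obtain k l x y where t: "lattice_triangle a b c n k l \<in> gasket_triangles a b c n"
    and z: "z = oblique a b c x y"
    and bounds: "0 \<le> 2 ^ n * x - real k" "0 \<le> 2 ^ n * y - real l"
      "(2 ^ n * x - real k) + (2 ^ n * y - real l) \<le> 1"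
    by auto
  have "z \<notin> medial_hole (lattice_triangle a b c n k l)"
    using Suc.prems t by (fastforce simp: medial_hole_def)
  then consider "1/2 \<le> 2 ^ n * x - real k" | "1/2 \<le> 2 ^ n * y - real l"
    | "(2 ^ n * x - real k) + (2 ^ n * y - real l) \<le> 1/2"
    unfolding z oblique_in_medial_hole_iff[OF nc] by linarith
  then show ?case
  proof cases
    case 1
    then show ?thesis
      using gasket_triangles_subdivide(2)[OF t] z bounds
      by (intro exI[of _ "2 * k + 1"] exI[of _ "2 * l"] exI[of _ x] exI[of _ y]) auto
  next
    case 2
    then show ?thesis
      using gasket_triangles_subdivide(3)[OF t] z bounds
      by (intro exI[of _ "2 * k"] exI[of _ "2 * l + 1"] exI[of _ x] exI[of _ y]) auto
  next
    case 3
    then show ?thesis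
      using gasket_triangles_subdivide(1)[OF t] z bounds
      by (intro exI[of _ "2 * k"] exI[of _ "2 * l"] exI[of _ x] exI[of _ y]) auto
  qed
qed

text \<open>
  The barycentre of the medial triangle has coordinates \<open>(1/3, 1/3)\<close>, and the box of radius \<open>1/12\<close>
  around it lies in the open hole, since \<open>1/3 + 1/12 < 1/2 = 2 (1/3 - 1/12)\<close>. A grid triangle that covers
  a point of this box is the one that contains the box.
\<close>

lemma sierpinski_gasket_avoids:
  fixes a b c :: "real^2"
  assumes nc: "\<not> collinear {a, b, c}" and z: "oblique a b c x y \<in> sierpinski_gasket a b c"
    and x: "\<bar>2 ^ n * x - (1/3 + of_int k)\<bar> < 1/12" and y: "\<bar>2 ^ n * y - (1/3 + of_int l)\<bar> < 1/12"
  shows False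
proof -
  have stage: "oblique a b c x y \<in> gasket_stage a b c m" for m
    using z by (simp add: sierpinski_gasket_def)
  obtain k' l' where t: "lattice_triangle a b c n k' l' \<in> gasket_triangles a b c n"
    and bounds: "0 \<le> 2 ^ n * x - real k'" "0 \<le> 2 ^ n * y - real l'"
      "(2 ^ n * x - real k') + (2 ^ n * y - real l') \<le> 1"
    using gasket_stage_covered[OF nc stage[of n]] by (auto simp: oblique_eq_iff[OF nc])
  \<comment> \<open>The fractional parts in the box lie strictly between \<open>1/4\<close> and \<open>5/12\<close>, so the covering cell can only
    be the one with corner \<open>(k, l)\<close>.\<close>
  have "of_int (k - int k') < (1::real)" "- 1 < (of_int (k - int k') :: real)"
    "of_int (l - int l') < (1::real)" "- 1 < (of_int (l - int l') :: real)"
    using x y bounds unfolding of_int_diff of_int_of_nat_eq by linarith+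
  then have "k = int k'" "l = int l'"
    by linarith+
  then have "oblique a b c x y \<in> medial_hole (lattice_triangle a b c n k' l')"
    unfolding oblique_in_medial_hole_iff[OF nc] using x y unfolding abs_less_iff by simp
  then show False
    using stage[of "Suc n"] t by (fastforce simp: medial_hole_def)
qed

text \<open>
  On the edge \<open>y = 0\<close> the inequalities \<open>X < 1/2\<close> and \<open>1/2 < X + Y\<close> of a hole are incompatible, as
  \<open>Y \<le> 0\<close> there.
\<close>

lemma edge_subset_sierpinski_gasket:
  fixes a b c :: "real^2"
  assumes nc: "\<not> collinear {a, b, c}"
  shows "closed_segment a b \<subseteq> sierpinski_gasket a b c"
proof
  fix z assume z: "z \<in> closed_segment a b"
  then obtain x where x: "0 \<le> x" "x \<le> 1" "z = oblique a b c x 0"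
    by (auto simp: in_segment oblique_def algebra_simps)
  have "z \<notin> medial_hole t" if "t \<in> gasket_triangles a b c n" for n t
    using gasket_triangles_lattice[OF that] by (auto simp: x(3) oblique_in_medial_hole_iff[OF nc])
  moreover have "z \<in> convex hull {a, b, c}"
    using z hull_mono[of "{a, b}" "{a, b, c}"] by (auto simp: segment_convex_hull)
  ultimately have "z \<in> gasket_stage a b c n" for n
    by (induction n) (fastforce simp: medial_hole_def)+
  then show "z \<in> sierpinski_gasket a b c"
    by (simp add: sierpinski_gasket_def)
qed

lemma lipschitz_dim_sierpinski_gasket:
  fixes a b c :: "real^2"
  assumes nc: "\<not> collinear {a, b, c}"
  shows "lipschitz_dim (submetric euclidean_metric (sierpinski_gasket a b c)) = 1"
proof -
  let ?G = "sierpinski_gasket a b c"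
  obtain x y M where "0 \<le> M" and coord: "\<And>s t. x (oblique a b c s t) = s" "\<And>s t. y (oblique a b c s t) = t"
    and lip: "\<And>z w. \<bar>x z - x w\<bar> \<le> M * dist z w" "\<And>z w. \<bar>y z - y w\<bar> \<le> M * dist z w"
    and colip: "\<And>s t s' t'. dist (oblique a b c s t) (oblique a b c s' t') \<le> M * (\<bar>s - s'\<bar> + \<bar>t - t'\<bar>)"
    using oblique_chart[OF nc] by metis
  have G0: "?G \<subseteq> gasket_stage a b c 0"
    unfolding sierpinski_gasket_def by (rule INT_lower) simp
  have z: "z = oblique a b c (x z) (y z)" if "z \<in> ?G" for z
    using gasket_stage_covered[OF nc subsetD[OF G0 that]] by (auto simp: coord)
  have "bounded ?G"
    using G0 by (rule bounded_subset[rotated]) (simp add: bounded_convex_hull)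
  then have "lipschitz_light (submetric euclidean_metric ?G) (Rn_metric 1)
      (\<lambda>z i. if i = 0 then y z - x z / (1/12) else 0)"
  proof (rule lipschitz_light_of_lattice_holes[where N = 2 and M = M and s = "1/3" and t = "1/3", rotated 3])
    fix z w assume "z \<in> ?G" "w \<in> ?G"
    then show "dist z w \<le> M * (\<bar>x z - x w\<bar> + \<bar>y z - y w\<bar>)"
      using colip z by metis
  next
    fix n k l z
    assume "z \<in> ?G" "\<bar>real 2 ^ n * x z - (1/3 + of_int k)\<bar> < 1/12"
      "\<bar>real 2 ^ n * y z - (1/3 + of_int l)\<bar> < 1/12"
    then show False
      using sierpinski_gasket_avoids[OF nc, of "x z" "y z" n k l] z by simp
  qed (use \<open>0 \<le> M\<close> lip in auto)
  moreover have "a \<noteq> b"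
    using nc by auto
  ultimately show ?thesis
    using lipschitz_dim_eq_1I[OF edge_subset_sierpinski_gasket[OF nc]] by blast
qed

section \<open>Equilateral triangles\<close>

text \<open>
  Two sides \<open>u\<close>, \<open>v\<close> from a vertex satisfy \<open>2 (u \<bullet> v) = \<bar>u\<bar>\<^sup>2\<close> by the law of cosines, while collinearity
  is the equality case \<open>\<bar>u \<bullet> v\<bar> = \<bar>u\<bar> \<bar>v\<bar>\<close> of the Cauchy-Schwarz inequality.
\<close>

lemma equilateral_not_collinear:
  assumes "equilateral a b c"
  shows "\<not> collinear {a, b, c}"
proof
  define u where "u = b - a"
  define v where "v = c - a"
  assume "collinear {a, b, c}"
  then have "collinear {0, u, v}"
    using collinear_3[of b a c] by (simp add: insert_commute u_def v_def)
  then have "\<bar>u \<bullet> v\<bar> = norm u * norm v"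
    by (simp add: norm_cauchy_schwarz_equal)
  moreover have uv: "norm v = norm u" "norm (u - v) = norm u" "u \<noteq> 0"
    using assms by (auto simp: equilateral_def u_def v_def dist_norm norm_minus_commute)
  moreover have "2 * (u \<bullet> v) = norm u ^ 2 + norm v ^ 2 - norm (u - v) ^ 2"
    by (simp add: power2_norm_eq_inner inner_diff_left inner_diff_right inner_commute)
  ultimately have "2 * (u \<bullet> v) = norm u ^ 2" "\<bar>u \<bullet> v\<bar> = norm u ^ 2" "0 < norm u ^ 2"
    by (simp_all add: power2_eq_square)
  then show False
    by linarith
qed

theorem corollary5p17:
  shows "(\<forall>p::nat. odd p \<and> p \<ge> 3 \<longrightarrow>
            lipschitz_dim (submetric euclidean_metric (sierpinski_carpet p)) = 1)
       \<and> (\<forall>a b c :: real^2. equilateral a b c \<longrightarrow>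
            lipschitz_dim (submetric euclidean_metric (sierpinski_gasket a b c)) = 1)"
  using lipschitz_dim_sierpinski_carpet lipschitz_dim_sierpinski_gasket equilateral_not_collinear
  by blast

end
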